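(* Let $\mathcal F$ be a family of smooth functions from $\mathbb{R}^m$ to $\mathbb{C}$. Then $\mathcal F$ is uniformly of complex type if and only if the gradients $\{\nabla_x F\mid x\in\mathbb{R}^m,\ F\in\mathcal F\}$ span an isotropic subspace of $\mathbb{R}^m\otimes\mathbb{C}$, i.e. if and only if for all $F,G\in\mathcal F$ and all $x,y\in\mathbb{R}^m$: $$(\nabla_x F)^T\,\nabla_y G=0.$$
   Context: For smooth $F:\mathbb{R}^m\to\mathbb{C}$, $\nabla_xF=\nabla_x\operatorname{Re}F+i\nabla_x\operatorname{Im}F\in\mathbb{R}^m\otimes\mathbb{C}=\mathbb{C}^m$ is the Euclidean gradient at $x$, and $v^Tw=\sum_j v_jw_j$ is the complex bilinear pairing (no conjugation). A complex linear subspace $V\subseteq\mathbb{R}^m\otimes\mathbb{C}$ is isotropic if $v^Tw=0$ for all $v,w\in V$. A family $\mathcal F$ of functions $\mathbb{R}^m\to\mathbb{C}$ is uniformly of complex type if there are $k\geq 0$, an orthogonal projection $\pi:\mathbb{R}^m\to\mathbb{C}^k$ (i.e. the adjoint of an isometric $\mathbb{R}$-linear embedding $\mathbb{C}^k\cong\mathbb{R}^{2k}\to\mathbb{R}^m$), and a family $\mathcal G$ of holomorphic maps $\mathbb{C}^k\to\mathbb{C}$ so that $\mathcal F=\{G\circ\pi\mid G\in\mathcal G\}$. *)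

theory Defs
  imports "HOL-Analysis.Analysis"
begin

text \<open>
  The standing convention is that the domain \<open>\<real>\<^sup>m\<close> is the type \<open>real ^ 'm\<close> and
  \<open>\<real>\<^sup>m \<otimes> \<complex>\<close> is \<open>complex ^ 'm\<close>, whose complex-linear structure (scalar
  multiplication \<open>(*s)\<close>, \<open>vec.subspace\<close>, \<open>vec.span\<close>) is the library's.
\<close>

text \<open>
  In finite dimensions, continuity of all directional derivatives
  \<open>x \<mapsto> f'(x) v\<close> is continuity of \<open>f'\<close>, so \<open>cont_diff n\<close> is \<open>C\<^sup>n\<close>.
\<close>

primrec cont_diff :: "nat \<Rightarrow> ('a::euclidean_space \<Rightarrow> 'b::real_normed_vector) \<Rightarrow> bool" where
  "cont_diff 0 f \<longleftrightarrow> continuous_on UNIV f"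
| "cont_diff (Suc n) f \<longleftrightarrow>
     (\<forall>x. f differentiable (at x)) \<and>
     (\<forall>v. cont_diff n (\<lambda>x. frechet_derivative f (at x) v))"

definition smooth :: "('a::euclidean_space \<Rightarrow> 'b::real_normed_vector) \<Rightarrow> bool" where
  "smooth f \<longleftrightarrow> (\<forall>n. cont_diff n f)"

definition gradient :: "('a::euclidean_space \<Rightarrow> real) \<Rightarrow> 'a \<Rightarrow> 'a" where
  "gradient f x = (THE D. GDERIV f x :> D)"

definition cgradient :: "(real ^ 'm::finite \<Rightarrow> complex) \<Rightarrow> real ^ 'm \<Rightarrow> complex ^ 'm" where
  "cgradient F x =
     (\<chi> j. of_real (gradient (\<lambda>u. Re (F u)) x $ j) + \<i> * of_real (gradient (\<lambda>u. Im (F u)) x $ j))"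

text \<open>Bilinear, not sesquilinear: on \<open>complex ^ 'm\<close> the library's inner product is a different, real-valued form.\<close>

definition bilin :: "complex ^ 'm::finite \<Rightarrow> complex ^ 'm \<Rightarrow> complex" where
  "bilin v w = (\<Sum>j\<in>UNIV. v $ j * w $ j)"

definition isotropic :: "(complex ^ 'm::finite) set \<Rightarrow> bool" where
  "isotropic V \<longleftrightarrow> vec.subspace V \<and> (\<forall>v\<in>V. \<forall>w\<in>V. bilin v w = 0)"

text \<open>
  The dimension \<open>k \<ge> 0\<close> of \<open>\<complex>\<^sup>k\<close> is bound by an existential quantifier below, so it cannot
  be a type. Vectors of \<open>\<complex>\<^sup>k\<close> are sequences vanishing from index \<open>k\<close> on, as in the library's
  \<open>Euclidean_space\<close>. Functions on \<open>\<complex>\<^sup>k\<close> are only ever evaluated on this carrier.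
\<close>

definition Cn :: "nat \<Rightarrow> (nat \<Rightarrow> complex) set" where
  "Cn k = {z. \<forall>i\<ge>k. z i = 0}"

definition Cn_norm :: "nat \<Rightarrow> (nat \<Rightarrow> complex) \<Rightarrow> real" where
  "Cn_norm k z = L2_set (\<lambda>j. norm (z j)) {..<k}"

text \<open>
  The real inner product of \<open>\<complex>\<^sup>k \<cong> \<real>\<^sup>2\<^sup>k\<close>; the summands are the real inner products of
  complex numbers.
\<close>

definition Cn_inner :: "nat \<Rightarrow> (nat \<Rightarrow> complex) \<Rightarrow> (nat \<Rightarrow> complex) \<Rightarrow> real" where
  "Cn_inner k z w = (\<Sum>j<k. z j \<bullet> w j)"

text \<open>
  Complex Frechet differentiability at every point of \<open>\<complex>\<^sup>k\<close>. The derivative, a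
  complex-linear functional on \<open>\<complex>\<^sup>k\<close>, is given by its coefficients \<open>a\<close>.
\<close>

definition holomorphic_Cn :: "nat \<Rightarrow> ((nat \<Rightarrow> complex) \<Rightarrow> complex) \<Rightarrow> bool" where
  "holomorphic_Cn k G \<longleftrightarrow>
     (\<forall>z\<in>Cn k. \<exists>a :: nat \<Rightarrow> complex. \<forall>e>0. \<exists>d>0. \<forall>h\<in>Cn k. Cn_norm k h < d \<longrightarrow>
        norm (G (\<lambda>j. z j + h j) - G z - (\<Sum>j<k. a j * h j)) \<le> e * Cn_norm k h)"

definition isometric_embedding_Cn :: "nat \<Rightarrow> ((nat \<Rightarrow> complex) \<Rightarrow> real ^ 'm::finite) \<Rightarrow> bool" where
  "isometric_embedding_Cn k \<iota> \<longleftrightarrow>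
     (\<forall>z\<in>Cn k. \<forall>w\<in>Cn k. \<iota> (\<lambda>j. z j + w j) = \<iota> z + \<iota> w) \<and>
     (\<forall>r::real. \<forall>z\<in>Cn k. \<iota> (\<lambda>j. r *\<^sub>R z j) = r *\<^sub>R \<iota> z) \<and>
     (\<forall>z\<in>Cn k. norm (\<iota> z) = Cn_norm k z)"

definition orthogonal_projection_Cn :: "nat \<Rightarrow> (real ^ 'm::finite \<Rightarrow> nat \<Rightarrow> complex) \<Rightarrow> bool" where
  "orthogonal_projection_Cn k \<pi> \<longleftrightarrow>
     range \<pi> \<subseteq> Cn k \<and>
     (\<exists>\<iota>. isometric_embedding_Cn k \<iota> \<and> (\<forall>z\<in>Cn k. \<forall>x. \<iota> z \<bullet> x = Cn_inner k z (\<pi> x)))"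

definition uniformly_of_complex_type :: "(real ^ 'm::finite \<Rightarrow> complex) set \<Rightarrow> bool" where
  "uniformly_of_complex_type \<F> \<longleftrightarrow>
     (\<exists>k \<pi> \<G>. orthogonal_projection_Cn k \<pi> \<and>
        (\<forall>G\<in>\<G>. holomorphic_Cn k G) \<and>
        \<F> = {G \<circ> \<pi> |G. G \<in> \<G>})"

end

theory Submission imports Defs begin

text \<open>
  A system \<open>w\<close> of vectors in \<open>\<complex>\<^sup>m\<close> defines the real-linear map \<open>\<pi> x = (w\<^sub>j\<^sup>T x)\<^sub>j\<close> to \<open>\<complex>\<^sup>k\<close>, and
  \<open>\<pi>\<close> is an orthogonal projection exactly if the \<open>w\<^sub>j\<close> are Hermitian orthogonal of squared norm 2
  and span an isotropic subspace. The chain rule puts all gradients of \<open>G \<circ> \<pi>\<close>, \<open>G\<close> holomorphic,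
  into that span. Conversely, take for \<open>w\<close> a rescaled Hermitian orthonormal basis of an isotropic
  space containing all gradients, and let \<open>\<iota>\<close> be the adjoint of \<open>\<pi>\<close>. The derivative of \<open>F\<close> is then
  a complex combination of the components of \<open>\<pi>\<close>, so that \<open>F\<close> is constant along the kernel of
  \<open>\<pi>\<close>, whence \<open>F = (F \<circ> \<iota>) \<circ> \<pi>\<close>, and \<open>F \<circ> \<iota>\<close> is holomorphic.
\<close>

section \<open>Bilinear pairing, complexification and conjugation\<close>

definition cvec :: "real ^ 'm::finite \<Rightarrow> complex ^ 'm" where
  "cvec x = (\<chi> l. of_real (x $ l))"

text \<open>Puts both forms in terms of \<open>bilin\<close>: \<open>bilin v w\<close> measures
  isotropy, while \<open>bilin v (vcnj w)\<close> is the Hermitian form, linear in \<open>v\<close>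
  and antilinear in \<open>w\<close>.\<close>

definition vcnj :: "complex ^ 'm::finite \<Rightarrow> complex ^ 'm" where
  "vcnj v = (\<chi> l. cnj (v $ l))"

lemma bilin_add_left: "bilin (u + v) w = bilin u w + bilin v w"
  by (simp add: bilin_def algebra_simps sum.distrib)

lemma bilin_diff_left: "bilin (u - v) w = bilin u w - bilin v w"
  by (simp add: bilin_def algebra_simps sum_subtractf)

lemma bilin_scale_left: "bilin (c *s v) w = c * bilin v w"
  by (simp add: bilin_def sum_distrib_left algebra_simps)

lemma bilin_sum_left: "bilin (\<Sum>i\<in>A. f i) w = (\<Sum>i\<in>A. bilin (f i) w)"
  by (induction A rule: infinite_finite_induct) (auto simp: bilin_add_left, simp_all add: bilin_def)

lemma bilin_commute: "bilin v w = bilin w v"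
  by (simp add: bilin_def mult.commute)

lemma bilin_add_right: "bilin w (u + v) = bilin w u + bilin w v"
  by (simp add: bilin_commute[of w] bilin_add_left)

lemma bilin_scale_right: "bilin v (c *s w) = c * bilin v w"
  by (metis bilin_commute bilin_scale_left)

lemma bilin_sum_right: "bilin w (\<Sum>i\<in>A. f i) = (\<Sum>i\<in>A. bilin w (f i))"
  by (simp add: bilin_commute[of w] bilin_sum_left)

lemma cvec_add: "cvec (x + y) = cvec x + cvec y"
  by (simp add: cvec_def vec_eq_iff)

lemma cvec_scaleR: "cvec (r *\<^sub>R x) = of_real r *s cvec x"
  by (simp add: cvec_def vec_eq_iff)

lemma vcnj_scale: "vcnj (c *s v) = cnj c *s vcnj v"
  by (simp add: vcnj_def vec_eq_iff)

lemma bilin_vcnj_commute: "bilin w (vcnj v) = cnj (bilin v (vcnj w))"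
  by (simp add: bilin_def vcnj_def mult.commute)

lemma Re_bilin_vcnj: "Re (bilin v (vcnj w)) = v \<bullet> w"
  by (simp add: bilin_def vcnj_def inner_vec_def inner_complex_def)

lemma bilin_vcnj_self: "bilin v (vcnj v) = of_real ((norm v)\<^sup>2)"
proof (rule complex_eqI)
  show "Re (bilin v (vcnj v)) = Re (of_real ((norm v)\<^sup>2))"
    by (simp only: Re_bilin_vcnj power2_norm_eq_inner Re_complex_of_real)
  have "Im (bilin v (vcnj v)) = - Im (bilin v (vcnj v))"
    using arg_cong[OF bilin_vcnj_commute[of v v], of Im] by simp
  then show "Im (bilin v (vcnj v)) = Im (of_real ((norm v)\<^sup>2))"
    by simp
qed

section \<open>Hermitian orthonormal systems\<close>

definition hermitian_orthonormal :: "nat \<Rightarrow> (nat \<Rightarrow> complex ^ 'm::finite) \<Rightarrow> bool" where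
  "hermitian_orthonormal k w \<longleftrightarrow>
     (\<forall>i<k. \<forall>j<k. bilin (w i) (vcnj (w j)) = (if i = j then 1 else 0))"

text \<open>The real part of the Hermitian form is the real inner product, so the system is also
  orthonormal, hence independent, over the reals. The bound by the real dimension, twice the complex
  one, suffices for its purpose: a system of maximal length exists.\<close>

lemma hermitian_orthonormal_bound:
  fixes w :: "nat \<Rightarrow> complex ^ 'm::finite"
  assumes "hermitian_orthonormal k w"
  shows "k \<le> DIM(complex ^ 'm)"
proof -
  have inn: "w i \<bullet> w j = (if i = j then 1 else 0)" if "i < k" "j < k" for i j
    using assms that unfolding hermitian_orthonormal_def by (metis Re_bilin_vcnj one_complex.sel(1) zero_complex.sel(1))
  have inj: "inj_on w {..<k}"
    by (rule inj_onI) (metis inn lessThan_iff zero_neq_one)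
  have "pairwise orthogonal (w ` {..<k})"
    by (auto simp: pairwise_def orthogonal_def inn)
  moreover have "0 \<notin> w ` {..<k}"
    using inn by force
  ultimately have "independent (w ` {..<k})"
    by (rule pairwise_orthogonal_independent)
  then have "card (w ` {..<k}) \<le> DIM(complex ^ 'm)"
    using independent_bound by blast
  then show ?thesis
    by (simp add: card_image inj)
qed

text \<open>A maximal orthonormal system in the subspace spans it, since a nonzero residual would extend it.\<close>

lemma hermitian_orthonormal_basis_exists:
  fixes V :: "(complex ^ 'm::finite) set"
  assumes V: "vec.subspace V"
  obtains k w where "hermitian_orthonormal k w" "\<And>j. j < k \<Longrightarrow> w j \<in> V"
    "\<And>v. v \<in> V \<Longrightarrow> v = (\<Sum>j<k. bilin v (vcnj (w j)) *s w j)"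
proof -
  define P where "P k \<longleftrightarrow> (\<exists>w. hermitian_orthonormal k w \<and> (\<forall>j<k. w j \<in> V))" for k
  have "P 0"
    by (simp add: P_def hermitian_orthonormal_def)
  moreover have "\<And>k. P k \<Longrightarrow> k \<le> DIM(complex ^ 'm)"
    using hermitian_orthonormal_bound unfolding P_def by blast
  ultimately obtain k where k: "P k" "\<And>l. P l \<Longrightarrow> l \<le> k"
    using Nat.ex_has_greatest_nat by blast
  then obtain w where w: "hermitian_orthonormal k w" "\<And>j. j < k \<Longrightarrow> w j \<in> V"
    unfolding P_def by blast
  have "v = (\<Sum>j<k. bilin v (vcnj (w j)) *s w j)" if v: "v \<in> V" for v
  proof (rule ccontr)
    assume neq: "v \<noteq> (\<Sum>j<k. bilin v (vcnj (w j)) *s w j)"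
    define r where "r = v - (\<Sum>j<k. bilin v (vcnj (w j)) *s w j)"
    have r0: "norm r \<noteq> 0" using neq by (simp add: r_def)
    have rV: "r \<in> V"
      unfolding r_def by (intro vec.subspace_diff vec.subspace_sum vec.subspace_scale V v w) auto
    have ro: "bilin r (vcnj (w i)) = 0" if "i < k" for i
    proof -
      have "(\<Sum>j<k. bilin v (vcnj (w j)) * bilin (w j) (vcnj (w i)))
          = (\<Sum>j<k. if j = i then bilin v (vcnj (w i)) else 0)"
        by (rule sum.cong) (use w(1) that in \<open>auto simp: hermitian_orthonormal_def\<close>)
      then show ?thesis
        using that by (simp add: r_def bilin_diff_left bilin_sum_left bilin_scale_left)
    qed
    define u where "u = complex_of_real (inverse (norm r)) *s r"
    have uo: "bilin u (vcnj (w i)) = 0" "bilin (w i) (vcnj u) = 0" if "i < k" for i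
      using ro[OF that] bilin_vcnj_commute[of "w i" r]
      by (simp_all add: u_def vcnj_scale bilin_scale_left bilin_scale_right)
    have uu: "bilin u (vcnj u) = 1"
      using r0 by (simp add: u_def vcnj_scale bilin_scale_left bilin_scale_right
          bilin_vcnj_self power2_eq_square field_simps)
    have "hermitian_orthonormal (Suc k) (w(k := u))"
      using w(1) uo uu by (auto simp: hermitian_orthonormal_def less_Suc_eq)
    moreover have "u \<in> V"
      unfolding u_def by (intro vec.subspace_scale V rV)
    ultimately have "P (Suc k)"
      unfolding P_def using w(2) by (intro exI[of _ "w(k := u)"]) (auto simp: less_Suc_eq)
    then show False using k(2) by fastforce
  qed
  with w that show ?thesis by blast
qed

section \<open>Gradients, derivatives and isotropic spans\<close>

lemma gradient_eq:
  fixes f :: "real ^ 'm::finite \<Rightarrow> real"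
  assumes "(f has_derivative D) (at x)"
  shows "gradient f x = (\<chi> l. D (axis l 1))"
proof -
  have lin: "linear D"
    using assms has_derivative_linear by blast
  have "D h = h \<bullet> (\<chi> l. D (axis l 1))" for h
  proof -
    have "D h = D (\<Sum>l\<in>UNIV. (h $ l) *\<^sub>R axis l 1)"
      using basis_expansion[of h] by (simp add: scalar_mult_eq_scaleR)
    also have "\<dots> = h \<bullet> (\<chi> l. D (axis l 1))"
      by (simp add: linear_sum[OF lin] linear_scale[OF lin] inner_vec_def)
    finally show ?thesis .
  qed
  then have D: "D = (\<lambda>h. h \<bullet> (\<chi> l. D (axis l 1)))"
    by blast
  \<comment> \<open>\<open>gradient\<close> is a definite description: existence comes from the
    representation \<open>D\<close> of the derivative, uniqueness from that of the Frechet
    derivative.\<close>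
  show ?thesis
    unfolding gradient_def
  proof (rule the_equality)
    show "GDERIV f x :> (\<chi> l. D (axis l 1))"
      using assms D unfolding gderiv_def by simp
    fix E assume "GDERIV f x :> E"
    then have "D = (\<lambda>h. h \<bullet> E)"
      using assms has_derivative_unique unfolding gderiv_def by blast
    with D show "E = (\<chi> l. D (axis l 1))"
      by (metis vector_eq_ldot)
  qed
qed

lemma cgradient_eq:
  fixes F :: "real ^ 'm::finite \<Rightarrow> complex"
  assumes "(F has_derivative D) (at x)"
  shows "cgradient F x = (\<chi> l. D (axis l 1))"
  using gradient_eq[OF has_derivative_Re[OF assms]] gradient_eq[OF has_derivative_Im[OF assms]]
  by (simp add: cgradient_def vec_eq_iff complex_eq_iff)

text \<open>Turns an expansion of the gradient in vectors \<open>w j\<close> into an expansion of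
  the derivative in the functionals \<open>bilin (w j) (cvec h)\<close>.\<close>

lemma derivative_eq_bilin_cgradient:
  fixes F :: "real ^ 'm::finite \<Rightarrow> complex"
  assumes "(F has_derivative D) (at x)"
  shows "D h = bilin (cgradient F x) (cvec h)"
proof -
  have lin: "linear D"
    using assms has_derivative_linear by blast
  have "D h = D (\<Sum>l\<in>UNIV. (h $ l) *\<^sub>R axis l 1)"
    using basis_expansion[of h] by (simp add: scalar_mult_eq_scaleR)
  also have "\<dots> = (\<Sum>l\<in>UNIV. (h $ l) *\<^sub>R D (axis l 1))"
    by (simp add: linear_sum[OF lin] linear_scale[OF lin])
  also have "\<dots> = bilin (cgradient F x) (cvec h)"
    by (simp add: bilin_def cvec_def cgradient_eq[OF assms] scaleR_conv_of_real mult.commute)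
  finally show ?thesis .
qed

text \<open>The vectors pairing to zero with a fixed \<open>w\<close> form a complex subspace, so
  vanishing passes from generators to the span in one argument, and then by symmetry in the
  other.\<close>

lemma isotropic_span_iff:
  "isotropic (vec.span S) \<longleftrightarrow> (\<forall>v\<in>S. \<forall>w\<in>S. bilin v w = 0)"
proof
  assume S: "\<forall>v\<in>S. \<forall>w\<in>S. bilin v w = 0"
  have sub: "vec.subspace {v. bilin v w = 0}" for w :: "complex ^ 'a"
    by (simp add: vec.subspace_def bilin_add_left bilin_scale_left) (simp add: bilin_def)
  have 1: "bilin v w = 0" if "v \<in> vec.span S" "w \<in> S" for v w
    using vec.span_minimal[OF _ sub[of w], of S] S that by blast
  have "bilin v w = 0" if "v \<in> vec.span S" "w \<in> vec.span S" for v w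
    using vec.span_minimal[OF _ sub[of w], of S] 1[OF that(2)] that(1) bilin_commute
    by (metis (mono_tags, lifting) mem_Collect_eq subsetD subsetI)
  then show "isotropic (vec.span S)"
    by (simp add: isotropic_def)
qed (simp add: isotropic_def vec.span_base)

section \<open>Isometric embeddings of \<open>Cn k\<close> and their adjoints\<close>

lemma Cn_norm_nonneg [simp]: "0 \<le> Cn_norm k z"
  by (simp add: Cn_norm_def)

lemma Cn_norm_power2: "(Cn_norm k z)\<^sup>2 = Cn_inner k z z"
  by (simp add: Cn_norm_def L2_set_def Cn_inner_def sum_nonneg power2_norm_eq_inner)

text \<open>Polarization: expand the squared norm of \<open>\<iota> z + \<iota> w\<close> on both
  sides of the isometry.\<close>

lemma isometric_embedding_Cn_inner:
  assumes "isometric_embedding_Cn k \<iota>" "z \<in> Cn k" "w \<in> Cn k"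
  shows "\<iota> z \<bullet> \<iota> w = Cn_inner k z w"
proof -
  have n: "\<iota> u \<bullet> \<iota> u = Cn_inner k u u" if "u \<in> Cn k" for u
    using assms(1) that Cn_norm_power2[of k u]
    by (simp add: isometric_embedding_Cn_def flip: power2_norm_eq_inner)
  have "(\<lambda>j. z j + w j) \<in> Cn k"
    using assms by (simp add: Cn_def)
  from n[OF this] have "(\<iota> z + \<iota> w) \<bullet> (\<iota> z + \<iota> w) = Cn_inner k (\<lambda>j. z j + w j) (\<lambda>j. z j + w j)"
    using assms by (simp add: isometric_embedding_Cn_def)
  also have "\<dots> = Cn_inner k z z + 2 * Cn_inner k z w + Cn_inner k w w"
    by (simp add: Cn_inner_def inner_add inner_commute sum.distrib sum_distrib_left algebra_simps)
  finally show ?thesis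
    using n assms by (simp add: inner_add inner_commute)
qed

text \<open>Testing adjointness on the real basis vectors \<open>e 1 j\<close> and
  \<open>e \<i> j\<close> gives Re and Im of component \<open>j\<close> as inner products with their
  images \<open>a j\<close> and \<open>b j\<close>, so \<open>w j\<close> is \<open>a j\<close> plus
  \<i> times \<open>b j\<close>. As \<iota> is isometric, all \<open>a j\<close> and
  \<open>b j\<close> together are orthonormal, so in \<open>bilin (w i) (w j)\<close> the real terms
  cancel and the mixed ones vanish.\<close>

lemma orthogonal_projection_Cn_isotropic_rows:
  fixes \<pi> :: "real ^ 'm::finite \<Rightarrow> nat \<Rightarrow> complex"
  assumes "orthogonal_projection_Cn k \<pi>"
  obtains w where "\<And>x j. j < k \<Longrightarrow> \<pi> x j = bilin (w j) (cvec x)"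
    "\<And>i j. i < k \<Longrightarrow> j < k \<Longrightarrow> bilin (w i) (w j) = 0"
proof -
  obtain \<iota> where \<iota>: "isometric_embedding_Cn k \<iota>"
    and adj: "\<And>z x. z \<in> Cn k \<Longrightarrow> \<iota> z \<bullet> x = Cn_inner k z (\<pi> x)"
    using assms unfolding orthogonal_projection_Cn_def by blast
  define e :: "complex \<Rightarrow> nat \<Rightarrow> nat \<Rightarrow> complex" where "e c j = (\<lambda>i. if i = j then c else 0)" for c j
  define a where "a j = \<iota> (e 1 j)" for j
  define b where "b j = \<iota> (e \<i> j)" for j
  define w where "w j = cvec (a j) + \<i> *s cvec (b j)" for j
  have e: "e c j \<in> Cn k" if "j < k" for c j
    using that by (simp add: Cn_def e_def)
  have inner_e: "Cn_inner k (e c j) z = c \<bullet> z j" if "j < k" for c j z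
  proof -
    have "Cn_inner k (e c j) z = (\<Sum>i<k. if i = j then c \<bullet> z i else 0)"
      unfolding Cn_inner_def by (rule sum.cong) (auto simp: e_def)
    then show ?thesis using that by simp
  qed
  have bilin_cvec: "bilin (cvec x) (cvec y) = of_real (x \<bullet> y)" for x y :: "real ^ 'm"
    by (simp add: bilin_def cvec_def inner_vec_def)
  have "\<pi> x j = bilin (w j) (cvec x)" if "j < k" for x j
    using adj[OF e[OF that, of 1], of x] adj[OF e[OF that, of \<i>], of x]
    by (simp add: w_def bilin_add_left bilin_scale_left bilin_cvec a_def b_def inner_e that
        complex_eq_iff inner_complex_def)
  moreover have "bilin (w i) (w j) = 0" if "i < k" "j < k" for i j
  proof -
    have ip: "\<iota> (e c i) \<bullet> \<iota> (e d j) = (if i = j then c \<bullet> d else 0)" for c d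
      using isometric_embedding_Cn_inner[OF \<iota> e[OF that(1)] e[OF that(2)], of c d]
      by (simp add: inner_e that) (simp add: e_def)
    have "bilin (w i) (w j) = of_real (a i \<bullet> a j) - of_real (b i \<bullet> b j)
        + \<i> * (of_real (a i \<bullet> b j) + of_real (b i \<bullet> a j))"
      by (simp add: w_def bilin_add_left bilin_add_right bilin_scale_left bilin_scale_right
          bilin_cvec algebra_simps)
    then show ?thesis
      by (simp add: a_def b_def ip inner_complex_def)
  qed
  ultimately show ?thesis by (rule that)
qed

text \<open>Cauchy-Schwarz for \<open>\<iota> (\<pi> x) \<bullet> x\<close>, which adjointness
  identifies with the squared norm of \<open>\<pi> x\<close>. The bound carries error estimates from
  \<open>Cn k\<close> back to the real domain.\<close>

lemma Cn_norm_orthogonal_projection_le: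
  assumes "orthogonal_projection_Cn k \<pi>"
  shows "Cn_norm k (\<pi> x) \<le> norm x"
proof -
  obtain \<iota> where \<iota>: "isometric_embedding_Cn k \<iota>"
    and adj: "\<And>z x. z \<in> Cn k \<Longrightarrow> \<iota> z \<bullet> x = Cn_inner k z (\<pi> x)" and r: "\<pi> x \<in> Cn k"
    using assms unfolding orthogonal_projection_Cn_def by blast
  have "Cn_norm k (\<pi> x) * Cn_norm k (\<pi> x) = \<iota> (\<pi> x) \<bullet> x"
    using adj[OF r] Cn_norm_power2[of k "\<pi> x"] by (simp add: power2_eq_square)
  also have "\<dots> \<le> norm (\<iota> (\<pi> x)) * norm x"
    by (rule norm_cauchy_schwarz)
  also have "\<dots> = Cn_norm k (\<pi> x) * norm x"
    using \<iota> r by (simp add: isometric_embedding_Cn_def)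
  finally show ?thesis
    using Cn_norm_nonneg[of k "\<pi> x"] norm_ge_zero[of x]
    by (cases "Cn_norm k (\<pi> x) = 0") (auto simp: mult_le_cancel_left)
qed

section \<open>Complex type implies isotropic gradients\<close>

lemma holomorphic_comp_projection_cgradient:
  fixes \<pi> :: "real ^ 'm::finite \<Rightarrow> nat \<Rightarrow> complex"
  assumes \<pi>: "orthogonal_projection_Cn k \<pi>" and G: "holomorphic_Cn k G"
    and w: "\<And>x j. j < k \<Longrightarrow> \<pi> x j = bilin (w j) (cvec x)"
  obtains a where "cgradient (G \<circ> \<pi>) x = (\<Sum>j<k. a j *s w j)"
proof -
  have ran: "\<pi> y \<in> Cn k" for y
    using \<pi> unfolding orthogonal_projection_Cn_def by blast
  \<comment> \<open>The rows \<open>w\<close> describe only the indices below \<open>k\<close>; from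
    \<open>k\<close> on, all terms are 0 by membership in \<open>Cn k\<close>.\<close>
  have \<pi>add: "\<pi> (u + v) j = \<pi> u j + \<pi> v j" for u v j
    using ran[of "u + v"] ran[of u] ran[of v]
    by (cases "j < k") (auto simp: w cvec_add bilin_add_right Cn_def)
  obtain a where a: "\<And>e. e > 0 \<Longrightarrow> \<exists>d>0. \<forall>h\<in>Cn k. Cn_norm k h < d \<longrightarrow>
        norm (G (\<lambda>j. \<pi> x j + h j) - G (\<pi> x) - (\<Sum>j<k. a j * h j)) \<le> e * Cn_norm k h"
    using G ran[of x] unfolding holomorphic_Cn_def by blast
  \<comment> \<open>The derivative predicted by the chain rule. Being the pairing with a combination
    of the \<open>w j\<close>, it has that combination as its complex gradient.\<close>
  define D where "D h = (\<Sum>j<k. a j * \<pi> h j)" for h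
  have D: "D h = bilin (\<Sum>j<k. a j *s w j) (cvec h)" for h
    by (simp add: D_def w bilin_sum_left bilin_scale_left)
  have "linear D"
    by (rule linearI)
      (simp_all add: D cvec_add cvec_scaleR bilin_add_right bilin_scale_right
        scaleR_conv_of_real[where 'a=complex])
  then have "bounded_linear D"
    by (simp add: linear_conv_bounded_linear)
  moreover have "\<exists>d>0. \<forall>y. norm (y - x) < d \<longrightarrow>
      norm ((G \<circ> \<pi>) y - (G \<circ> \<pi>) x - D (y - x)) \<le> e * norm (y - x)" if e: "e > 0" for e
  proof -
    obtain d where d: "d > 0" "\<And>h. h \<in> Cn k \<Longrightarrow> Cn_norm k h < d \<Longrightarrow>
        norm (G (\<lambda>j. \<pi> x j + h j) - G (\<pi> x) - (\<Sum>j<k. a j * h j)) \<le> e * Cn_norm k h"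
      using a[OF e] by blast
    have "norm ((G \<circ> \<pi>) y - (G \<circ> \<pi>) x - D (y - x)) \<le> e * norm (y - x)"
      if "norm (y - x) < d" for y
    proof -
      have le: "Cn_norm k (\<pi> (y - x)) \<le> norm (y - x)"
        by (rule Cn_norm_orthogonal_projection_le[OF \<pi>])
      have "(\<lambda>j. \<pi> x j + \<pi> (y - x) j) = \<pi> y"
        using \<pi>add[of x "y - x"] by (simp add: fun_eq_iff)
      then have "norm ((G \<circ> \<pi>) y - (G \<circ> \<pi>) x - D (y - x)) \<le> e * Cn_norm k (\<pi> (y - x))"
        using d(2)[OF ran, of "y - x"] le that by (simp add: D_def)
      also have "\<dots> \<le> e * norm (y - x)"
        using le e by simp
      finally show ?thesis .
    qed
    with d(1) show ?thesis by blast
  qed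
  ultimately have "(G \<circ> \<pi> has_derivative D) (at x)"
    unfolding has_derivative_at_alt by blast
  then have "cgradient (G \<circ> \<pi>) x = (\<chi> l. D (axis l 1))"
    by (rule cgradient_eq)
  also have "\<dots> = (\<Sum>j<k. a j *s w j)"
  proof -
    have "bilin v (cvec (axis l 1)) = v $ l" for v :: "complex ^ 'm" and l
    proof -
      have "bilin v (cvec (axis l 1)) = (\<Sum>i\<in>UNIV. if i = l then v $ i else 0)"
        unfolding bilin_def by (rule sum.cong) (auto simp: cvec_def axis_def)
      then show ?thesis by simp
    qed
    then show ?thesis by (simp add: D vec_eq_iff)
  qed
  finally show ?thesis by (rule that)
qed

lemma uniformly_of_complex_type_imp_bilin_cgradient:
  assumes "uniformly_of_complex_type \<F>" "F \<in> \<F>" "G \<in> \<F>"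
  shows "bilin (cgradient F x) (cgradient G y) = 0"
proof -
  obtain k \<pi> \<G> where \<pi>: "orthogonal_projection_Cn k \<pi>" and hol: "\<And>G. G \<in> \<G> \<Longrightarrow> holomorphic_Cn k G"
    and \<F>: "\<F> = {G \<circ> \<pi> |G. G \<in> \<G>}"
    using assms(1) unfolding uniformly_of_complex_type_def by blast
  obtain w where w: "\<And>x j. j < k \<Longrightarrow> \<pi> x j = bilin (w j) (cvec x)"
    and iso: "\<And>i j. i < k \<Longrightarrow> j < k \<Longrightarrow> bilin (w i) (w j) = 0"
    using orthogonal_projection_Cn_isotropic_rows[OF \<pi>] by blast
  obtain F' G' where FG: "F = F' \<circ> \<pi>" "F' \<in> \<G>" "G = G' \<circ> \<pi>" "G' \<in> \<G>"
    using assms(2,3) \<F> by blast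
  obtain a where a: "cgradient F x = (\<Sum>j<k. a j *s w j)"
    using holomorphic_comp_projection_cgradient[OF \<pi> hol[OF FG(2)] w] FG(1) by blast
  obtain b where b: "cgradient G y = (\<Sum>j<k. b j *s w j)"
    using holomorphic_comp_projection_cgradient[OF \<pi> hol[OF FG(4)] w] FG(3) by blast
  show ?thesis
    by (simp add: a b bilin_sum_left bilin_sum_right bilin_scale_left bilin_scale_right iso)
qed

section \<open>Isotropic gradients imply complex type\<close>

lemma isotropic_imp_uniformly_of_complex_type:
  fixes \<F> :: "(real ^ 'm::finite \<Rightarrow> complex) set"
  assumes diff: "\<And>F x. F \<in> \<F> \<Longrightarrow> F differentiable (at x)"
    and V: "isotropic V" and grad: "\<And>F x. F \<in> \<F> \<Longrightarrow> cgradient F x \<in> V"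
  shows "uniformly_of_complex_type \<F>"
proof -
  obtain k u where u: "hermitian_orthonormal k u" "\<And>j. j < k \<Longrightarrow> u j \<in> V"
    and exp: "\<And>v. v \<in> V \<Longrightarrow> v = (\<Sum>j<k. bilin v (vcnj (u j)) *s u j)"
    using V hermitian_orthonormal_basis_exists unfolding isotropic_def by metis
  \<comment> \<open>For \<open>v\<close> isotropic, \<open>Re v\<close> and \<open>Im v\<close> are orthogonal with norm \<open>norm v / sqrt 2\<close>.\<close>
  define w where "w j = complex_of_real (sqrt 2) *s u j" for j
  have s2: "complex_of_real (sqrt 2) * complex_of_real (sqrt 2) = 2"
    by (simp flip: of_real_mult)
  have ww: "bilin (w i) (w j) = 0" if "i < k" "j < k" for i j
    using V u(2) that by (simp add: w_def bilin_scale_left bilin_scale_right isotropic_def)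
  have wc: "bilin (w i) (vcnj (w j)) = (if i = j then 2 else 0)" if "i < k" "j < k" for i j
  proof -
    have "bilin (w i) (vcnj (w j))
        = (complex_of_real (sqrt 2) * complex_of_real (sqrt 2)) * bilin (u i) (vcnj (u j))"
      by (simp add: w_def bilin_scale_left bilin_scale_right vcnj_scale)
    then show ?thesis
      using u(1) that unfolding s2 by (simp add: hermitian_orthonormal_def)
  qed
  define \<pi> where "\<pi> x = (\<lambda>j. if j < k then bilin (w j) (cvec x) else 0)" for x
  \<comment> \<open>The adjoint of \<pi>: coordinate \<open>l\<close> is the real inner product of
    \<open>z\<close> with the image under \<pi> of the standard basis vector
    \<open>axis l 1\<close>, whose entry \<open>i\<close> is \<open>w i $ l\<close>.\<close>
  define \<iota> :: "(nat \<Rightarrow> complex) \<Rightarrow> real ^ 'm"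
    where "\<iota> z = (\<chi> l. \<Sum>i<k. Re (z i * cnj (w i $ l)))" for z
  have \<pi>Cn: "\<pi> x \<in> Cn k" for x
    by (simp add: \<pi>_def Cn_def)
  have \<iota>add: "\<iota> (\<lambda>j. z j + h j) = \<iota> z + \<iota> h" for z h
    by (simp add: \<iota>_def vec_eq_iff sum.distrib algebra_simps)
  have \<iota>scale: "\<iota> (\<lambda>j. r *\<^sub>R z j) = r *\<^sub>R \<iota> z" for r z
    by (simp add: \<iota>_def vec_eq_iff sum_distrib_left algebra_simps)
  have \<pi>diff: "\<pi> (x - y) j = \<pi> x j - \<pi> y j" for x y j
  proof -
    have "bilin (w j) (cvec x) = bilin (w j) (cvec (x - y)) + bilin (w j) (cvec y)"
      using cvec_add[of "x - y" y] by (simp add: bilin_add_right)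
    then show ?thesis by (simp add: \<pi>_def)
  qed
  \<comment> \<open>Each real part is half the sum of a number and its conjugate.\<close>
  have cvec\<iota>: "cvec (\<iota> z) = (\<Sum>i<k. (z i / 2) *s vcnj (w i) + (cnj (z i) / 2) *s w i)" for z
    by (simp add: cvec_def \<iota>_def vcnj_def vec_eq_iff sum_component)
      (intro allI sum.cong refl, simp add: complex_eq_iff field_simps)
  \<comment> \<open>Isotropy kills the terms in \<open>w i\<close>; in the terms in
    \<open>vcnj (w i)\<close>, squared norm 2 cancels the factor 1/2.\<close>
  have \<pi>\<iota>: "\<pi> (\<iota> z) j = z j" if "j < k" for z j
  proof -
    have "\<pi> (\<iota> z) j = (\<Sum>i<k. z i / 2 * bilin (w j) (vcnj (w i)) + cnj (z i) / 2 * bilin (w j) (w i))"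
      using that by (simp add: \<pi>_def cvec\<iota> bilin_sum_right bilin_add_right bilin_scale_right)
    also have "\<dots> = (\<Sum>i<k. if i = j then z j else 0)"
      by (rule sum.cong) (use that in \<open>auto simp: ww wc\<close>)
    finally show ?thesis using that by simp
  qed
  have adj: "\<iota> z \<bullet> x = Cn_inner k z (\<pi> x)" for z x
  proof -
    have "\<iota> z \<bullet> x = (\<Sum>l\<in>UNIV. \<Sum>i<k. Re (z i * cnj (w i $ l)) * (x $ l))"
      by (simp add: \<iota>_def inner_vec_def sum_distrib_right)
    also have "\<dots> = (\<Sum>i<k. \<Sum>l\<in>UNIV. Re (z i * cnj (w i $ l)) * (x $ l))"
      by (rule sum.swap)
    also have "\<dots> = Cn_inner k z (\<pi> x)"
      by (simp add: Cn_inner_def \<pi>_def bilin_def cvec_def inner_sum_right)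
        (simp add: inner_complex_def algebra_simps)
    finally show ?thesis .
  qed
  \<comment> \<open>By adjointness the squared norm of \<open>\<iota> z\<close> is the inner product
    of \<open>z\<close> with \<open>\<pi> (\<iota> z)\<close>, which agrees with \<open>z\<close>
    below \<open>k\<close>.\<close>
  have \<iota>norm: "norm (\<iota> z) = Cn_norm k z" for z
  proof (rule power2_eq_imp_eq)
    show "(norm (\<iota> z))\<^sup>2 = (Cn_norm k z)\<^sup>2"
      unfolding power2_norm_eq_inner Cn_norm_power2 adj by (simp add: Cn_inner_def \<pi>\<iota>)
  qed auto
  have proj: "orthogonal_projection_Cn k \<pi>"
    unfolding orthogonal_projection_Cn_def isometric_embedding_Cn_def
    using \<pi>Cn \<iota>add \<iota>scale \<iota>norm adj by blast
  have dF: "\<exists>c. (F has_derivative (\<lambda>h. \<Sum>j<k. c j * \<pi> h j)) (at x)" if F: "F \<in> \<F>" for F x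
  proof -
    obtain D where D: "(F has_derivative D) (at x)"
      using diff[OF F] unfolding differentiable_def by blast
    \<comment> \<open>Coefficients of the gradient in the rescaled basis \<open>w\<close>, hence the
      division by \<open>sqrt 2\<close>.\<close>
    define c where "c j = bilin (cgradient F x) (vcnj (u j)) / complex_of_real (sqrt 2)" for j
    have "cgradient F x = (\<Sum>j<k. c j *s w j)"
      using exp[OF grad[OF F]] by (simp add: c_def w_def)
    then have "D h = (\<Sum>j<k. c j * \<pi> h j)" for h
      by (simp add: derivative_eq_bilin_cgradient[OF D] bilin_sum_left bilin_scale_left \<pi>_def)
    then have "D = (\<lambda>h. \<Sum>j<k. c j * \<pi> h j)"
      by blast
    with D show ?thesis by blast
  qed
  have hol: "holomorphic_Cn k (F \<circ> \<iota>)" if F: "F \<in> \<F>" for F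
    unfolding holomorphic_Cn_def
  proof
    fix z assume "z \<in> Cn k"
    obtain c where c: "(F has_derivative (\<lambda>h. \<Sum>j<k. c j * \<pi> h j)) (at (\<iota> z))"
      using dF[OF F] by blast
    show "\<exists>a. \<forall>e>0. \<exists>d>0. \<forall>h\<in>Cn k. Cn_norm k h < d \<longrightarrow>
        norm ((F \<circ> \<iota>) (\<lambda>j. z j + h j) - (F \<circ> \<iota>) z - (\<Sum>j<k. a j * h j)) \<le> e * Cn_norm k h"
    \<comment> \<open>The real derivative is already complex linear along \<iota>: at
      \<open>\<iota> h\<close> its value is the sum of \<open>c j * h j\<close>. The same
      \<open>d\<close> works because \<iota> preserves norms.\<close>
    proof (intro exI[of _ c] allI impI)
      fix e :: real assume "e > 0"
      then obtain d where "d > 0" and d: "\<And>y. norm (y - \<iota> z) < d \<Longrightarrow>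
          norm (F y - F (\<iota> z) - (\<Sum>j<k. c j * \<pi> (y - \<iota> z) j)) \<le> e * norm (y - \<iota> z)"
        using c unfolding has_derivative_at_alt by blast
      have "norm ((F \<circ> \<iota>) (\<lambda>j. z j + h j) - (F \<circ> \<iota>) z - (\<Sum>j<k. c j * h j)) \<le> e * Cn_norm k h"
        if "Cn_norm k h < d" for h
        using d[of "\<iota> z + \<iota> h"] that by (simp add: \<iota>add \<iota>norm \<pi>\<iota>)
      with \<open>d > 0\<close> show "\<exists>d>0. \<forall>h\<in>Cn k. Cn_norm k h < d \<longrightarrow>
        norm ((F \<circ> \<iota>) (\<lambda>j. z j + h j) - (F \<circ> \<iota>) z - (\<Sum>j<k. c j * h j)) \<le> e * Cn_norm k h"
        by blast
    qed
  qed
  \<comment> \<open>\<open>x - \<iota> (\<pi> x)\<close> lies in the kernel of \<open>\<pi>\<close>, along which all derivatives of \<open>F\<close> vanish.\<close>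
  have comp: "(F \<circ> \<iota>) \<circ> \<pi> = F" if F: "F \<in> \<F>" for F
  proof
    fix x
    define y where "y = \<iota> (\<pi> x)"
    \<comment> \<open>Joins \<open>g 0\<close>, the value at \<open>x\<close> of the composition, to
      \<open>g 1\<close>, which is \<open>F x\<close>.\<close>
    define g where "g t = F (y + t *\<^sub>R (x - y))" for t :: real
    have ker: "\<pi> (t *\<^sub>R (x - y)) j = 0" for t j
    proof -
      have "\<pi> (x - y) j = 0"
        using \<pi>\<iota>[of j "\<pi> x"] by (cases "j < k") (simp add: \<pi>diff y_def, simp add: \<pi>_def)
      then show ?thesis
        by (simp add: \<pi>_def cvec_scaleR bilin_scale_right split: if_splits)
    qed
    have "(g has_derivative (\<lambda>h. 0)) (at t within UNIV)" for t
    proof -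
      obtain c where c: "(F has_derivative (\<lambda>h. \<Sum>j<k. c j * \<pi> h j)) (at (y + t *\<^sub>R (x - y)))"
        using dF[OF F] by blast
      have "((\<lambda>t. y + t *\<^sub>R (x - y)) has_derivative (\<lambda>t. t *\<^sub>R (x - y))) (at t)"
        by (auto intro!: derivative_eq_intros)
      from has_derivative_compose[OF this c] show ?thesis
        by (simp add: g_def[abs_def] ker)
    qed
    then obtain c where "\<And>t. g t = c"
      using has_derivative_zero_constant[of UNIV g] by auto
    then have "g 0 = g 1" by simp
    then show "((F \<circ> \<iota>) \<circ> \<pi>) x = F x"
      by (simp add: g_def y_def)
  qed
  have "\<F> = {G \<circ> \<pi> |G. G \<in> (\<lambda>F. F \<circ> \<iota>) ` \<F>}"
    (is "_ = ?R")
  proof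
    show "\<F> \<subseteq> ?R"
    proof
      fix F assume "F \<in> \<F>"
      then show "F \<in> ?R"
        using comp[of F] by (intro CollectI exI[of _ "F \<circ> \<iota>"]) simp
    qed
    show "?R \<subseteq> \<F>"
    proof
      fix F assume "F \<in> ?R"
      then obtain F' where "F' \<in> \<F>" "F = (F' \<circ> \<iota>) \<circ> \<pi>"
        by blast
      then show "F \<in> \<F>" by (simp only: comp)
    qed
  qed
  moreover have "\<forall>G\<in>(\<lambda>F. F \<circ> \<iota>) ` \<F>. holomorphic_Cn k G"
    using hol by blast
  ultimately show ?thesis
    using proj unfolding uniformly_of_complex_type_def by (intro exI conjI)
qed

section \<open>The equivalence for smooth families\<close>

lemma smooth_imp_differentiable: "smooth f \<Longrightarrow> f differentiable (at x)"
  unfolding smooth_def by (metis cont_diff.simps(2))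

theorem theorem3:
  fixes \<F> :: "(real ^ 'm::finite \<Rightarrow> complex) set"
  assumes "\<forall>F\<in>\<F>. smooth F"
  shows "(uniformly_of_complex_type \<F> \<longleftrightarrow>
            isotropic (vec.span {cgradient F x |F x. F \<in> \<F>})) \<and>
         (isotropic (vec.span {cgradient F x |F x. F \<in> \<F>}) \<longleftrightarrow>
            (\<forall>F\<in>\<F>. \<forall>G\<in>\<F>. \<forall>x y. bilin (cgradient F x) (cgradient G y) = 0))"
proof -
  let ?S = "{cgradient F x |F x. F \<in> \<F>}"
  have iso: "isotropic (vec.span ?S) \<longleftrightarrow>
      (\<forall>F\<in>\<F>. \<forall>G\<in>\<F>. \<forall>x y. bilin (cgradient F x) (cgradient G y) = 0)"
    unfolding isotropic_span_iff by blast
  have "cgradient F x \<in> vec.span ?S" if "F \<in> \<F>" for F x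
    using that by (intro vec.span_base) blast
  \<comment> \<open>The span of the gradients itself serves as the isotropic space containing
    them.\<close>
  then have "uniformly_of_complex_type \<F>" if "isotropic (vec.span ?S)"
    using isotropic_imp_uniformly_of_complex_type[OF _ that] assms smooth_imp_differentiable
    by blast
  with iso show ?thesis
    using uniformly_of_complex_type_imp_bilin_cgradient by blast
qed

end
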